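(* Let $u,v\in\mathbb{N}$ and let $A$ be a $u\times v$ matrix with entries from $\mathbb{Q}[i]$ which is image partition regular over $\mathbb{Z}[i]$. The following are equivalent: (a) For every piecewise syndetic subset $P$ of $\mathbb{Z}[i]\setminus\{0\}$ (piecewise syndetic in $(\mathbb{Z}[i],+)$), there exists $\vec{z}\in(\mathbb{Z}[i]\setminus\{0\})^{v}$ such that $A\vec{z}\in P^{u}$; (b) There exists $\vec{z}\in(\mathbb{Z}[i])^{v}$ such that $A\vec{z}=\vec{1}$, where $\vec{1}$ denotes the vector in $(\mathbb{Z}[i])^{u}$ whose entries are all equal to $1$.
   Context: $\mathbb{Z}[i]$ is the ring of Gaussian integers and $\mathbb{Q}[i]=\{a+bi:a,b\in\mathbb{Q}\}$. A $u\times v$ matrix $A$ with entries in $\mathbb{Q}[i]$ is image partition regular over $\mathbb{Z}[i]$ if for every $k\in\mathbb{N}$ and every partition $\mathbb{Z}[i]\setminus\{0\}=\bigcup_{j=1}^k D_j$ there are $j$ and $\vec{x}\in(\mathbb{Z}[i]\setminus\{0\})^v$ with $A\vec{x}\in D_j^u$. In a commutative semigroup $(S,+)$, a set $B\subseteq S$ is piecewise syndetic if there is a finite nonempty $G\subseteq S$ such that for every finite nonempty $F\subseteq S$ there is $x\in S$ with $F+x\subseteq\bigcup_{t\in G}(-t+B)$, where $-t+B=\{s\in S:t+s\in B\}$. For $P\subseteq\mathbb{Z}[i]$, $P^u$ is the set of vectors in $(\mathbb{Z}[i])^u$ all of whose entries lie in $P$. *)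

theory Defs
  imports "HOL-Analysis.Analysis"
begin

definition gauss_ints :: "complex set" where
  "gauss_ints = {of_int a + of_int b * \<i> | a b. True}"

definition gauss_rats :: "complex set" where
  "gauss_rats = {of_rat a + of_rat b * \<i> | a b. True}"

definition vectors_over :: "'a set \<Rightarrow> ('a ^ 'n) set" where
  "vectors_over P = {x. \<forall>r. x $ r \<in> P}"

text \<open>Cells of a partition are indexed by \<open>1, \<dots>, k\<close>; they are pairwise disjoint and may be empty.\<close>

definition image_partition_regular :: "complex ^ 'v ^ 'u \<Rightarrow> bool" where
  "image_partition_regular A \<longleftrightarrow>
     (\<forall>(k::nat) D. 0 < k \<longrightarrow> disjoint_family_on D {1..k} \<longrightarrow>
        gauss_ints - {0} = (\<Union>j\<in>{1..k}. D j) \<longrightarrow>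
        (\<exists>j\<in>{1..k}. \<exists>x\<in>vectors_over (gauss_ints - {0}). A *v x \<in> vectors_over (D j)))"

definition piecewise_syndetic_in :: "'a::ab_semigroup_add set \<Rightarrow> 'a set \<Rightarrow> bool" where
  "piecewise_syndetic_in S B \<longleftrightarrow>
     B \<subseteq> S \<and>
     (\<exists>G. finite G \<and> G \<noteq> {} \<and> G \<subseteq> S \<and>
        (\<forall>F. finite F \<longrightarrow> F \<noteq> {} \<longrightarrow> F \<subseteq> S \<longrightarrow>
           (\<exists>x\<in>S. (\<lambda>f. f + x) ` F \<subseteq> (\<Union>t\<in>G. {s \<in> S. t + s \<in> B}))))"

end

theory Submission
  imports Defs "HOL-Complex_Analysis.Great_Picard"
begin

text \<open>
  If \<open>A z = 1\<close> has no solution, then \<open>1\<close> lies outside the additive group \<open>L\<close> of all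
  \<open>A z\<close>, and adjoining suitable multiples of the finitely many generators of
  \<open>\<int>[i]\<^sup>u\<close> one at a time shows that \<open>1\<close> even lies outside \<open>L + n \<int>[i]\<^sup>u\<close> for
  some \<open>n\<close>; the syndetic set \<open>1 + n \<int>[i]\<close> then violates (a).
  Conversely, let \<open>P\<close> be piecewise syndetic, witnessed by the finite set \<open>G\<close>, and let
  \<open>A z = 1\<close>. Translates \<open>x\<^sub>n\<close> for an exhausting sequence of finite sets colour
  \<open>y\<close> by some \<open>t \<in> G\<close> with \<open>t + y + x\<^sub>n \<in> P\<close>. A pointwise limit of these colourings
  has a monochromatic image \<open>A w\<close>, and for large \<open>n\<close> the vector
  \<open>w + (t + x\<^sub>n) z\<close> is mapped into \<open>P\<close>. Its entries do not vanish if \<open>x\<^sub>n\<close> was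
  chosen to tend to infinity.
\<close>

section \<open>Gaussian integers\<close>

lemma gauss_intsI: "of_int a + of_int b * \<i> \<in> gauss_ints"
  unfolding gauss_ints_def by blast

lemma gauss_intsE:
  assumes "z \<in> gauss_ints"
  obtains a b where "z = of_int a + of_int b * \<i>"
  using assms unfolding gauss_ints_def by blast

lemma gauss_ints_of_int [simp]: "of_int a \<in> gauss_ints"
  using gauss_intsI[of a 0] by simp

lemma gauss_ints_of_nat [simp]: "of_nat a \<in> gauss_ints"
  using gauss_ints_of_int[of "int a"] by simp

lemma gauss_ints_0 [simp]: "0 \<in> gauss_ints"
  using gauss_ints_of_int[of 0] by simp

lemma gauss_ints_1 [simp]: "1 \<in> gauss_ints"
  using gauss_ints_of_int[of 1] by simp

lemma gauss_ints_add [simp]: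
  assumes "x \<in> gauss_ints" "y \<in> gauss_ints" shows "x + y \<in> gauss_ints"
proof -
  obtain a b c d where "x = of_int a + of_int b * \<i>" "y = of_int c + of_int d * \<i>"
    using assms by (meson gauss_intsE)
  then have "x + y = of_int (a + c) + of_int (b + d) * \<i>"
    by (simp add: algebra_simps)
  then show ?thesis by (metis gauss_intsI)
qed

lemma gauss_ints_mult [simp]:
  assumes "x \<in> gauss_ints" "y \<in> gauss_ints" shows "x * y \<in> gauss_ints"
proof -
  obtain a b c d where "x = of_int a + of_int b * \<i>" "y = of_int c + of_int d * \<i>"
    using assms by (meson gauss_intsE)
  then have "x * y = of_int (a * c - b * d) + of_int (a * d + b * c) * \<i>"
    by (simp add: complex_eq_iff)
  then show ?thesis by (metis gauss_intsI)
qed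

lemma gauss_ints_minus [simp]: "x \<in> gauss_ints \<Longrightarrow> - x \<in> gauss_ints"
  using gauss_ints_mult[of "of_int (-1)" x, OF gauss_ints_of_int] by simp

lemma gauss_ints_diff [simp]: "x \<in> gauss_ints \<Longrightarrow> y \<in> gauss_ints \<Longrightarrow> x - y \<in> gauss_ints"
  using gauss_ints_add[of x "- y"] by simp

lemma countable_gauss_ints: "countable gauss_ints"
proof -
  have "gauss_ints = range (\<lambda>(a, b). of_int a + of_int b * \<i>)"
    unfolding gauss_ints_def by auto
  then show ?thesis by (metis countableI_type countable_image)
qed

section \<open>Residual finiteness\<close>

definition additive_subgroup :: "'a::ab_group_add set \<Rightarrow> bool" where
  "additive_subgroup L \<longleftrightarrow> 0 \<in> L \<and> (\<forall>x\<in>L. \<forall>y\<in>L. x + y \<in> L) \<and> (\<forall>x\<in>L. - x \<in> L)"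

lemma additive_subgroupI:
  assumes "0 \<in> L" "\<And>x y. x \<in> L \<Longrightarrow> y \<in> L \<Longrightarrow> x + y \<in> L" "\<And>x. x \<in> L \<Longrightarrow> - x \<in> L"
  shows "additive_subgroup L"
  using assms unfolding additive_subgroup_def by blast

lemma
  assumes "additive_subgroup L"
  shows additive_subgroup_0: "0 \<in> L"
    and additive_subgroup_add: "x \<in> L \<Longrightarrow> y \<in> L \<Longrightarrow> x + y \<in> L"
    and additive_subgroup_minus: "x \<in> L \<Longrightarrow> - x \<in> L"
  using assms unfolding additive_subgroup_def by blast+

lemma additive_subgroup_scaleR_int:
  fixes L :: "'a::real_vector set"
  assumes L: "additive_subgroup L" and x: "x \<in> L"
  shows "of_int k *\<^sub>R x \<in> L"
proof -
  have nat: "of_nat m *\<^sub>R x \<in> L" for m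
    by (induction m)
      (auto simp: scaleR_left_distrib x intro: additive_subgroup_0[OF L] additive_subgroup_add[OF L])
  show ?thesis
  proof (cases "k \<ge> 0")
    case True
    then show ?thesis using nat[of "nat k"] by simp
  next
    case False
    then show ?thesis using additive_subgroup_minus[OF L nat[of "nat (- k)"]] by simp
  qed
qed

text \<open>If a positive multiple of \<open>e\<close> already lies in \<open>L\<close>, adjoining
  it changes nothing. Otherwise the coefficient of \<open>e\<close> in an element of
  \<open>L\<close> + Z\<open>e\<close> is unique, so if \<open>b\<close> has the nonzero coefficient
  \<open>k\<close>, adjoining \<open>2 * \<bar>k\<bar>\<close> times \<open>e\<close> keeps
  \<open>b\<close> out. If \<open>b\<close> is not in \<open>L\<close> + Z\<open>e\<close> at all,
  \<open>n = 1\<close> works.\<close>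

lemma additive_subgroup_adjoin_multiple:
  fixes L :: "'a::real_vector set"
  assumes L: "additive_subgroup L" and b: "b \<notin> L"
  obtains n :: int and L' where "n > 0" "additive_subgroup L'" "L \<subseteq> L'" "of_int n *\<^sub>R e \<in> L'" "b \<notin> L'"
proof -
  define adj where "adj n = {l + of_int (n * k) *\<^sub>R e | l k. l \<in> L}" for n :: int
  have adjI: "l + of_int (n * k) *\<^sub>R e \<in> adj n" if "l \<in> L" for l n k
    using that unfolding adj_def by blast
  have sub: "additive_subgroup (adj n)" for n
  proof (rule additive_subgroupI)
    show "0 \<in> adj n"
      using adjI[OF additive_subgroup_0[OF L], of n 0] by simp
  next
    fix x y assume "x \<in> adj n" "y \<in> adj n"
    then obtain l k l' k' where "x = l + of_int (n * k) *\<^sub>R e" "y = l' + of_int (n * k') *\<^sub>R e"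
      and l: "l \<in> L" "l' \<in> L"
      unfolding adj_def by blast
    then have "x + y = (l + l') + of_int (n * (k + k')) *\<^sub>R e"
      by (simp add: algebra_simps)
    then show "x + y \<in> adj n"
      using adjI[OF additive_subgroup_add[OF L l]] by metis
  next
    fix x assume "x \<in> adj n"
    then obtain l k where "x = l + of_int (n * k) *\<^sub>R e" and l: "l \<in> L"
      unfolding adj_def by blast
    then have "- x = - l + of_int (n * (- k)) *\<^sub>R e"
      by simp
    then show "- x \<in> adj n"
      using adjI[OF additive_subgroup_minus[OF L l]] by metis
  qed
  have le: "L \<subseteq> adj n" for n
  proof
    fix x assume "x \<in> L"
    then show "x \<in> adj n" using adjI[of x n 0] by simp
  qed
  have mem: "of_int n *\<^sub>R e \<in> adj n" for n
    using adjI[OF additive_subgroup_0[OF L], of n 1] by simp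
  have "\<exists>n>0. b \<notin> adj n"
  proof (cases "\<exists>d>0. of_int d *\<^sub>R e \<in> L")
    case True
    then obtain d :: int where d: "d > 0" "of_int d *\<^sub>R e \<in> L" by blast
    have "x \<in> L" if "x \<in> adj d" for x
    proof -
      from that obtain l k where x: "x = l + of_int (d * k) *\<^sub>R e" and l: "l \<in> L"
        unfolding adj_def by blast
      have "of_int (d * k) *\<^sub>R e = of_int k *\<^sub>R (of_int d *\<^sub>R e)"
        by (simp add: mult.commute)
      then show ?thesis
        using x additive_subgroup_add[OF L l additive_subgroup_scaleR_int[OF L d(2), of k]] by metis
    qed
    then show ?thesis using b d by blast
  next
    case free: False
    show ?thesis
    proof (cases "b \<in> adj 1")
      case True
      then obtain l k where b1: "b = l + of_int k *\<^sub>R e" and l: "l \<in> L"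
        unfolding adj_def by auto
      have k: "k \<noteq> 0" using b b1 l by auto
      have "b \<notin> adj (2 * \<bar>k\<bar>)"
      proof
        assume "b \<in> adj (2 * \<bar>k\<bar>)"
        then obtain l' k' where b2: "b = l' + of_int (2 * \<bar>k\<bar> * k') *\<^sub>R e" and l': "l' \<in> L"
          unfolding adj_def by blast
        \<comment> \<open>The difference of the coefficients of \<open>e\<close> in two
          representations of \<open>b\<close>. It is nonzero, since \<open>k\<close> is no multiple
          of \<open>2 * \<bar>k\<bar>\<close>, yet \<open>m\<close> times \<open>e\<close> falls
          into \<open>L\<close>, against \<open>free\<close>.\<close>
        define m where "m = k - 2 * \<bar>k\<bar> * k'"
        have "of_int m *\<^sub>R e = l' + - l"
          using b1 b2 by (simp add: m_def algebra_simps)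
        then have mL: "of_int m *\<^sub>R e \<in> L"
          using additive_subgroup_add[OF L l' additive_subgroup_minus[OF L l]] by simp
        then have mL': "of_int (- m) *\<^sub>R e \<in> L"
          using additive_subgroup_minus[OF L mL] by simp
        have "m \<noteq> 0"
        proof
          assume "m = 0"
          then have "k * 1 = k * (2 * (sgn k * k'))"
            unfolding m_def by (simp add: abs_sgn mult.assoc)
          then have "1 = 2 * (sgn k * k')" using k mult_left_cancel by blast
          then show False by presburger
        qed
        then have "m > 0 \<or> - m > 0" by linarith
        then show False using free mL mL' by blast
      qed
      then show ?thesis using k by (intro exI[of _ "2 * \<bar>k\<bar>"]) auto
    next
      case False
      then show ?thesis by (intro exI[of _ 1]) auto
    qed
  qed
  then show ?thesis using that sub le mem by blast
qed

text \<open>Treat the elements of \<open>E\<close> one after another. The product of the individual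
  multiples serves all of them, because a subgroup is closed under integer scaling.\<close>

lemma additive_subgroup_adjoin_multiples:
  fixes L :: "'a::real_vector set"
  assumes "finite E" "additive_subgroup L" "b \<notin> L"
  shows "\<exists>n L'. (n::int) > 0 \<and> additive_subgroup L' \<and> L \<subseteq> L' \<and> (\<forall>e\<in>E. of_int n *\<^sub>R e \<in> L') \<and> b \<notin> L'"
  using assms
proof (induction E arbitrary: L rule: finite_induct)
  case empty
  then show ?case by (intro exI[of _ 1] exI[of _ L]) auto
next
  case (insert e E)
  obtain n L1 where n: "n > 0" "additive_subgroup L1" "L \<subseteq> L1" "of_int n *\<^sub>R e \<in> L1" "b \<notin> L1"
    using additive_subgroup_adjoin_multiple insert.prems by metis
  from insert.IH[OF n(2,5)] obtain m :: int and L2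
    where m: "m > 0" "additive_subgroup L2" "L1 \<subseteq> L2" "\<forall>e\<in>E. of_int m *\<^sub>R e \<in> L2" "b \<notin> L2"
    by blast
  have "of_int (m * n) *\<^sub>R x \<in> L2" if x: "x \<in> insert e E" for x
  proof (cases "x = e")
    case True
    have "of_int n *\<^sub>R e \<in> L2" using n m by blast
    from additive_subgroup_scaleR_int[OF m(2) this, of m] show ?thesis
      using True by simp
  next
    case False
    then have "of_int m *\<^sub>R x \<in> L2" using x m by blast
    from additive_subgroup_scaleR_int[OF m(2) this, of n] show ?thesis
      by (simp add: mult.commute)
  qed
  moreover have "m * n > 0" using m n by simp
  ultimately show ?case using m n by blast
qed

lemma additive_subgroup_sum:
  assumes L: "additive_subgroup L" and "\<And>i. i \<in> I \<Longrightarrow> f i \<in> L"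
  shows "sum f I \<in> L"
  using assms(2)
  by (induction I rule: infinite_finite_induct)
    (auto intro: additive_subgroup_0[OF L] additive_subgroup_add[OF L])

text \<open>The vectors \<open>axis r 1\<close> and \<open>axis r \<i>\<close> generate the Gaussian
  integer vectors as an additive group, so only their \<open>n\<close>-fold multiples need to be
  known in \<open>L\<close>.\<close>

lemma gauss_vector_multiple_in_subgroup:
  fixes y :: "complex ^ 'u"
  assumes L: "additive_subgroup L" and y: "y \<in> vectors_over gauss_ints"
    and re: "\<And>r. of_int n *\<^sub>R axis r 1 \<in> L" and im: "\<And>r. of_int n *\<^sub>R axis r \<i> \<in> L"
  shows "of_int n *s y \<in> L"
proof -
  have "\<forall>r. \<exists>a b. y $ r = of_int a + of_int b * \<i>"
    using y unfolding vectors_over_def gauss_ints_def by blast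
  then obtain a b where ab: "\<And>r. y $ r = of_int (a r) + of_int (b r) * \<i>" by metis
  have "of_int n *s y = (\<Sum>r\<in>UNIV. of_int (a r) *\<^sub>R (of_int n *\<^sub>R axis r 1)
      + of_int (b r) *\<^sub>R (of_int n *\<^sub>R axis r \<i>))"
    by (simp add: vec_eq_iff ab axis_def sum.distrib scaleR_conv_of_real[where 'a = complex] algebra_simps
        if_distrib[where f = "\<lambda>x. _ * x"] cong: if_cong)
  also have "\<dots> \<in> L"
    by (intro additive_subgroup_sum[OF L] additive_subgroup_add[OF L]
        additive_subgroup_scaleR_int[OF L re] additive_subgroup_scaleR_int[OF L im])
  finally show ?thesis .
qed

text \<open>If \<open>b\<close> is not in the image group \<open>L\<close>, some larger subgroup
  \<open>L'\<close> still misses \<open>b\<close> but contains all \<open>n\<close>-fold Gaussian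
  vectors. A solution modulo this \<open>n\<close> would put \<open>b\<close> into
  \<open>L'\<close>.\<close>

lemma congruent_solvable_imp_solvable:
  fixes A :: "complex ^ 'v ^ 'u"
  assumes "\<And>n::int. n > 0 \<Longrightarrow> \<exists>z\<in>vectors_over gauss_ints. \<exists>y\<in>vectors_over gauss_ints. A *v z = b + of_int n *s y"
  shows "\<exists>z\<in>vectors_over gauss_ints. A *v z = b"
proof (rule ccontr)
  assume no: "\<not> ?thesis"
  define L where "L = (*v) A ` vectors_over gauss_ints"
  have L: "additive_subgroup L"
  proof (rule additive_subgroupI)
    show "0 \<in> L"
      unfolding L_def vectors_over_def by (auto intro!: image_eqI[where x = 0])
  next
    fix x y assume "x \<in> L" "y \<in> L"
    then obtain w z where "x = A *v w" "y = A *v z" "w + z \<in> vectors_over gauss_ints"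
      unfolding L_def vectors_over_def by auto
    then show "x + y \<in> L"
      unfolding L_def by (metis image_eqI matrix_vector_right_distrib)
  next
    fix x assume "x \<in> L"
    then obtain z where "x = A *v z" "- z \<in> vectors_over gauss_ints"
      unfolding L_def vectors_over_def by auto
    moreover have "A *v (- z) = - (A *v z)"
      by (simp add: vec_eq_iff matrix_vector_mult_def sum_negf)
    ultimately show "- x \<in> L"
      unfolding L_def by (metis image_eqI)
  qed
  have b: "b \<notin> L" using no unfolding L_def by blast
  let ?E = "range (\<lambda>r::'u. axis r (1::complex)) \<union> range (\<lambda>r::'u. axis r \<i>)"
  obtain n :: int and L' where n: "n > 0" and L': "additive_subgroup L'" "L \<subseteq> L'" "b \<notin> L'"
    and gens: "\<forall>e\<in>?E. of_int n *\<^sub>R e \<in> L'"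
    using additive_subgroup_adjoin_multiples[OF _ L b, of ?E] by (meson finite finite_UnI finite_imageI)
  obtain z y where z: "z \<in> vectors_over gauss_ints" and y: "y \<in> vectors_over gauss_ints"
    and eq: "A *v z = b + of_int n *s y"
    using assms[OF n] by blast
  have "of_int n *s y \<in> L'"
    using gens by (intro gauss_vector_multiple_in_subgroup[OF L'(1) y]) auto
  moreover have "A *v z \<in> L'" using z L' unfolding L_def by blast
  ultimately have "A *v z + - (of_int n *s y) \<in> L'"
    by (intro additive_subgroup_add[OF L'(1)] additive_subgroup_minus[OF L'(1)])
  then show False using eq L' by simp
qed

section \<open>Congruence classes as test sets for (a)\<close>

lemma piecewise_syndetic_congruence_class:
  assumes n: "n > 0"
  shows "piecewise_syndetic_in gauss_ints {1 + of_nat n * y | y. y \<in> gauss_ints}"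
proof -
  define P where "P = {1 + of_nat n * y | y. y \<in> gauss_ints}"
  let ?I = "{0..<int n}"
  let ?G = "(\<lambda>(a, b). of_int a + of_int b * \<i>) ` (?I \<times> ?I)"
  \<comment> \<open>The finitely many residues in \<open>?G\<close> move every Gaussian integer into
    the class, so the class is even syndetic and the translate 0 serves every finite set.\<close>
  have cover: "\<exists>t\<in>?G. t + s \<in> P" if s: "s \<in> gauss_ints" for s
  proof -
    have "1 - s \<in> gauss_ints" using s by simp
    then obtain a b where ab: "1 - s = of_int a + of_int b * \<i>" by (rule gauss_intsE)
    \<comment> \<open>Coordinatewise division of \<open>1 - s\<close> by \<open>n\<close>:
      \<open>t\<close> is the remainder and \<open>y\<close> the negated quotient, whence
      \<open>t + s = 1 + n * y\<close>.\<close>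
    define y where "y = - (of_int (a div int n) + of_int (b div int n) * \<i>)"
    define t where "t = of_int (a mod int n) + of_int (b mod int n) * \<i>"
    have a: "(of_int a :: complex) = of_nat n * of_int (a div int n) + of_int (a mod int n)"
      and b: "(of_int b :: complex) = of_nat n * of_int (b div int n) + of_int (b mod int n)"
      by (metis mult_div_mod_eq of_int_add of_int_mult of_int_of_nat_eq)+
    have "t + s = 1 - (of_int a + of_int b * \<i>) + t" using ab by (simp add: algebra_simps)
    also have "\<dots> = 1 + of_nat n * y"
      unfolding a b y_def t_def by (simp add: algebra_simps)
    finally have "t + s \<in> P"
      unfolding P_def y_def using gauss_intsI gauss_ints_minus by blast
    moreover have "t \<in> ?G" unfolding t_def using n by force
    ultimately show ?thesis by blast
  qed
  have "P \<subseteq> gauss_ints" unfolding P_def by auto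
  moreover have "finite ?G" by simp
  moreover have "?G \<noteq> {}" using n by simp
  moreover have "?G \<subseteq> gauss_ints" using gauss_intsI by auto
  moreover have "\<exists>x\<in>gauss_ints. (\<lambda>f. f + x) ` F \<subseteq> (\<Union>t\<in>?G. {s \<in> gauss_ints. t + s \<in> P})"
    if "F \<subseteq> gauss_ints" for F
    using that cover by (intro bexI[of _ 0]) auto
  ultimately show ?thesis
    unfolding piecewise_syndetic_in_def P_def[symmetric]
    by (intro conjI exI[of _ ?G] allI impI)
qed

text \<open>The real part of such an equation would make \<open>n\<close> divide 1. This keeps the
  test sets inside the nonzero Gaussian integers.\<close>

lemma one_not_multiple_gauss_ints:
  assumes n: "n \<ge> 2" and y: "y \<in> gauss_ints"
  shows "1 + of_nat n * y \<noteq> 0"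
proof
  assume eq: "1 + of_nat n * y = 0"
  obtain a b where ab: "y = of_int a + of_int b * \<i>" using y by (rule gauss_intsE)
  have "real_of_int (1 + int n * a) = 0"
    using eq ab by (simp add: complex_eq_iff)
  then have "int n dvd 1"
    by (metis add_eq_0_iff dvd_minus_iff dvd_triv_left of_int_eq_0_iff)
  then show False using n by simp
qed

lemma solvable_if_piecewise_syndetic_images:
  fixes A :: "complex ^ 'v ^ 'u"
  assumes a: "\<forall>P. P \<subseteq> gauss_ints - {0} \<longrightarrow> piecewise_syndetic_in gauss_ints P \<longrightarrow>
            (\<exists>z\<in>vectors_over (gauss_ints - {0}). A *v z \<in> vectors_over P)"
  shows "\<exists>z\<in>vectors_over gauss_ints. A *v z = (\<chi> r. 1)"
proof (rule congruent_solvable_imp_solvable)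
  fix n :: int assume n: "n > 0"
  \<comment> \<open>For \<open>n = 1\<close> the class of 1 would contain 0. Doubling the modulus
    avoids this, and a solution modulo \<open>2 * n\<close> is also one modulo
    \<open>n\<close>.\<close>
  define m where "m = 2 * nat n"
  let ?P = "{1 + of_nat m * y | y. y \<in> gauss_ints}"
  have "m \<ge> 2" using n unfolding m_def by simp
  then have "?P \<subseteq> gauss_ints - {0}" using one_not_multiple_gauss_ints by auto
  moreover have "piecewise_syndetic_in gauss_ints ?P"
    using \<open>m \<ge> 2\<close> by (intro piecewise_syndetic_congruence_class) simp
  ultimately obtain z where z: "z \<in> vectors_over (gauss_ints - {0})" "A *v z \<in> vectors_over ?P"
    using a by blast
  have "\<forall>r. \<exists>y. (A *v z) $ r = 1 + of_nat m * y \<and> y \<in> gauss_ints"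
    using z(2) unfolding vectors_over_def by blast
  then obtain y where y: "\<And>r. (A *v z) $ r = 1 + of_nat m * y r" "\<And>r. y r \<in> gauss_ints"
    by metis
  have "A *v z = (\<chi> r. 1) + of_int n *s (\<chi> r. of_nat 2 * y r)"
    using n by (simp add: vec_eq_iff y m_def)
  moreover have "(\<chi> r. of_nat 2 * y r) \<in> vectors_over gauss_ints"
    unfolding vectors_over_def using y(2) gauss_ints_mult[OF gauss_ints_of_nat[of 2]] by simp
  moreover have "z \<in> vectors_over gauss_ints" using z(1) unfolding vectors_over_def by simp
  ultimately show "\<exists>z\<in>vectors_over gauss_ints. \<exists>y\<in>vectors_over gauss_ints.
      A *v z = (\<chi> r. 1) + of_int n *s y"
    by blast
qed

section \<open>Images in piecewise syndetic sets\<close>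

text \<open>Apply the hypothesis to \<open>F\<close> together with its shift by a large integer
  \<open>N\<close>. Then both \<open>x\<close> and \<open>x + N\<close> are admissible translates,
  and as they differ by \<open>N > 2 * R\<close>, one of them has norm above
  \<open>R\<close>.\<close>

lemma gauss_translate_norm_gt:
  assumes thick: "\<And>F. finite F \<Longrightarrow> F \<noteq> {} \<Longrightarrow> F \<subseteq> gauss_ints \<Longrightarrow> \<exists>x\<in>gauss_ints. (\<lambda>f. f + x) ` F \<subseteq> T"
    and F: "finite F" "F \<noteq> {}" "F \<subseteq> gauss_ints"
  shows "\<exists>x\<in>gauss_ints. norm x > R \<and> (\<lambda>f. f + x) ` F \<subseteq> T"
proof -
  obtain N :: nat where N: "2 * R < real N" using reals_Archimedean2 by blast
  let ?s = "of_nat N :: complex"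
  have "\<exists>x\<in>gauss_ints. (\<lambda>f. f + x) ` (F \<union> (\<lambda>f. f + ?s) ` F) \<subseteq> T"
    by (rule thick) (use F in auto)
  then obtain x where x: "x \<in> gauss_ints" "(\<lambda>f. f + x) ` F \<subseteq> T" "(\<lambda>f. f + (x + ?s)) ` F \<subseteq> T"
    by (auto simp: image_Un image_image add_ac)
  have "real N \<le> norm (x + ?s) + norm x"
    using norm_triangle_ineq4[of "x + ?s" x] by simp
  then have "norm x > R \<or> norm (x + ?s) > R" using N by linarith
  then show ?thesis using x gauss_ints_add[OF x(1) gauss_ints_of_nat] by blast
qed

text \<open>Colours are complex numbers from a finite, hence bounded, set, so the diagonal argument
  on a countable domain gives a pointwise convergent subsequence. Convergence within a finite set is
  eventual constancy.\<close>

lemma finite_colourings_limit: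
  fixes c :: "nat \<Rightarrow> 'a \<Rightarrow> complex"
  assumes S: "countable S" and G: "finite G"
    and c: "\<And>y. y \<in> S \<Longrightarrow> \<forall>\<^sub>F n in sequentially. c n y \<in> G"
  obtains k :: "nat \<Rightarrow> nat" and l where "strict_mono k"
    "\<And>y. y \<in> S \<Longrightarrow> l y \<in> G" "\<And>y. y \<in> S \<Longrightarrow> \<forall>\<^sub>F n in sequentially. c (k n) y = l y"
proof -
  \<comment> \<open>A colour is in \<open>G\<close> only for large \<open>n\<close>, depending on
    \<open>y\<close>; the default 0 gives a bound uniform in \<open>n\<close> and
    \<open>y\<close>.\<close>
  define d where "d n y = (if c n y \<in> G then c n y else 0)" for n y
  have "\<exists>B. \<forall>z\<in>insert 0 G. norm z \<le> B"
    using finite_imp_bounded[of "insert 0 G"] G by (simp add: bounded_iff)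
  then obtain B where B: "\<And>z. z \<in> insert 0 G \<Longrightarrow> norm z \<le> B" by blast
  have "norm (d n y) \<le> B" for n y
    by (rule B) (simp add: d_def)
  then obtain k where k: "strict_mono k" and "\<And>y. y \<in> S \<Longrightarrow> \<exists>l. (\<lambda>n. d (k n) y) \<longlonglongrightarrow> l"
    using function_convergent_subsequence[OF S, of d B] by blast
  then obtain l where l: "\<And>y. y \<in> S \<Longrightarrow> (\<lambda>n. d (k n) y) \<longlonglongrightarrow> l y" by metis
  have main: "l y \<in> G \<and> (\<forall>\<^sub>F n in sequentially. c (k n) y = l y)" if y: "y \<in> S" for y
  proof -
    have ev: "\<forall>\<^sub>F n in sequentially. c (k n) y \<in> G"
      using c[OF y] k by (rule eventually_subseq[rotated])
    \<comment> \<open>This neighbourhood of \<open>l y\<close> contains no element of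
      \<open>G\<close> other than possibly \<open>l y\<close>, so a value in both it and
      \<open>G\<close> must be \<open>l y\<close>.\<close>
    have "open (- (G - {l y}))" using G by (intro open_Compl finite_imp_closed) simp
    then have "\<forall>\<^sub>F n in sequentially. d (k n) y \<in> - (G - {l y})"
      by (rule topological_tendstoD[OF l[OF y]]) simp
    with ev have *: "\<forall>\<^sub>F n in sequentially. c (k n) y = l y \<and> l y \<in> G"
      by eventually_elim (auto simp: d_def)
    then obtain n where "l y \<in> G" by (auto simp: eventually_sequentially)
    with * show ?thesis by (auto elim: eventually_mono)
  qed
  show ?thesis using that[OF k, of l] main by blast
qed

text \<open>Recasts partitions with cells numbered from 1 as colourings by a finite set
  \<open>G\<close>, through an enumeration \<open>h\<close> of the colours.\<close>

lemma image_partition_regular_finite_colouring: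
  fixes A :: "complex ^ 'v ^ 'u"
  assumes A: "image_partition_regular A"
    and G: "finite G" "\<And>y. y \<in> gauss_ints - {0} \<Longrightarrow> l y \<in> G"
  obtains t x where "t \<in> G" "x \<in> vectors_over (gauss_ints - {0})"
    "A *v x \<in> vectors_over {y \<in> gauss_ints - {0}. l y = t}"
proof -
  obtain h where h: "bij_betw h {1..card G} G"
    using G(1) ex_bij_betw_nat_finite_1 by blast
  define D where "D j = {y \<in> gauss_ints - {0}. l y = h j}" for j
  have "l 1 \<in> G" using G(2) by simp
  then have "0 < card G" using G(1) card_gt_0_iff by blast
  moreover have "disjoint_family_on D {1..card G}"
    unfolding disjoint_family_on_def
  proof (intro ballI impI)
    fix i j assume ij: "i \<in> {1..card G}" "j \<in> {1..card G}" "i \<noteq> j"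
    have "h i \<noteq> h j" using bij_betw_imp_inj_on[OF h] ij inj_onD by metis
    then show "D i \<inter> D j = {}" unfolding D_def by auto
  qed
  moreover have "gauss_ints - {0} = (\<Union>j\<in>{1..card G}. D j)"
  proof -
    have "\<exists>j\<in>{1..card G}. y \<in> D j" if y: "y \<in> gauss_ints - {0}" for y
    proof -
      have "l y \<in> h ` {1..card G}" using G(2)[OF y] bij_betw_imp_surj_on[OF h] by simp
      then show ?thesis using y unfolding D_def by auto
    qed
    moreover have "D j \<subseteq> gauss_ints - {0}" for j unfolding D_def by blast
    ultimately show ?thesis by blast
  qed
  ultimately obtain j x where j: "j \<in> {1..card G}" and x: "x \<in> vectors_over (gauss_ints - {0})"
    "A *v x \<in> vectors_over (D j)"
    using A[unfolded image_partition_regular_def, rule_format, of "card G" D] by blast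
  show ?thesis
    using that[OF bij_betwE[OF h, rule_format, OF j] x(1)] x(2) unfolding D_def .
qed

text \<open>Adding \<open>s *s z\<close> to the argument translates every entry of the image by
  \<open>s\<close>. Only the finitely many entries of one monochromatic image matter, so a limit
  colouring on all Gaussian integers suffices to find a common translate into
  \<open>P\<close>.\<close>

lemma piecewise_syndetic_image_if_solvable:
  fixes A :: "complex ^ 'v ^ 'u"
  assumes A: "image_partition_regular A"
    and z: "z \<in> vectors_over gauss_ints" "A *v z = (\<chi> r. 1)"
    and P: "piecewise_syndetic_in gauss_ints P"
  shows "\<exists>x\<in>vectors_over (gauss_ints - {0}). A *v x \<in> vectors_over P"
proof -
  obtain G where G: "finite G" "G \<subseteq> gauss_ints"
    and thick: "\<And>F. finite F \<Longrightarrow> F \<noteq> {} \<Longrightarrow> F \<subseteq> gauss_ints \<Longrightarrow>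
      \<exists>x\<in>gauss_ints. (\<lambda>f. f + x) ` F \<subseteq> (\<Union>t\<in>G. {s \<in> gauss_ints. t + s \<in> P})"
    using P unfolding piecewise_syndetic_in_def by (elim conjE exE) blast
  define e where "e = from_nat_into gauss_ints"
  have ne: "gauss_ints \<noteq> {}" using gauss_ints_0 by blast
  have e: "range e = gauss_ints"
    unfolding e_def using countable_gauss_ints ne by (rule range_from_nat_into[rotated])
  have "\<forall>n. \<exists>x\<in>gauss_ints. norm x > real n \<and>
      (\<lambda>f. f + x) ` (e ` {..n}) \<subseteq> (\<Union>t\<in>G. {s \<in> gauss_ints. t + s \<in> P})"
  proof
    fix n
    have "e ` {..n} \<subseteq> gauss_ints" using e by blast
    then show "\<exists>x\<in>gauss_ints. norm x > real n \<and>
        (\<lambda>f. f + x) ` (e ` {..n}) \<subseteq> (\<Union>t\<in>G. {s \<in> gauss_ints. t + s \<in> P})"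
      by (intro gauss_translate_norm_gt[OF thick]) simp_all
  qed
  then obtain x where x: "\<And>n. x n \<in> gauss_ints" "\<And>n. norm (x n) > real n"
    and xP: "\<And>n. (\<lambda>f. f + x n) ` (e ` {..n}) \<subseteq> (\<Union>t\<in>G. {s \<in> gauss_ints. t + s \<in> P})"
    unfolding Bex_def by (elim choice[THEN exE]) blast
  \<comment> \<open>The choice is meaningful once \<open>y\<close> is among the first
    \<open>n + 1\<close> enumerated points; before that it may be arbitrary, so its properties hold
    only eventually.\<close>
  define c where "c n y = (SOME t. t \<in> G \<and> t + (y + x n) \<in> P)" for n y
  have c: "\<forall>\<^sub>F n in sequentially. c n y \<in> G \<and> c n y + (y + x n) \<in> P" if y: "y \<in> gauss_ints" for y
  proof -
    obtain m where m: "y = e m" using y e by blast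
    have "c n y \<in> G \<and> c n y + (y + x n) \<in> P" if "n \<ge> m" for n
    proof -
      have "y + x n \<in> (\<lambda>f. f + x n) ` (e ` {..n})" using m that by blast
      then have "\<exists>t. t \<in> G \<and> t + (y + x n) \<in> P" using xP[of n] by blast
      then show ?thesis unfolding c_def by (rule someI_ex)
    qed
    then show ?thesis unfolding eventually_sequentially by blast
  qed
  have "\<forall>\<^sub>F n in sequentially. c n y \<in> G" if "y \<in> gauss_ints" for y
    using c[OF that] by (rule eventually_mono) simp
  from finite_colourings_limit[of gauss_ints G c, OF countable_gauss_ints G(1) this]
  obtain k l where k: "strict_mono (k :: nat \<Rightarrow> nat)" and l: "\<And>y. y \<in> gauss_ints \<Longrightarrow> l y \<in> G"
    and kl: "\<And>y. y \<in> gauss_ints \<Longrightarrow> \<forall>\<^sub>F n in sequentially. c (k n) y = l y"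
    by blast
  obtain t w where t: "t \<in> G" and w: "w \<in> vectors_over (gauss_ints - {0})"
    and Aw: "A *v w \<in> vectors_over {y \<in> gauss_ints - {0}. l y = t}"
    by (rule image_partition_regular_finite_colouring[OF A G(1), of l]) (use l in auto)
  \<comment> \<open>At each entry of \<open>A *v w\<close> the colour \<open>c (k n)\<close>
    eventually equals the limit colour, which is the same \<open>t\<close> for all entries.\<close>
  have ev1: "\<forall>\<^sub>F n in sequentially. \<forall>r. t + ((A *v w) $ r + x (k n)) \<in> P"
  proof (rule eventually_all_finite)
    fix r
    have y: "(A *v w) $ r \<in> gauss_ints" "l ((A *v w) $ r) = t"
      using Aw unfolding vectors_over_def by auto
    from eventually_subseq[OF k c[OF y(1)]] kl[OF y(1)]
    show "\<forall>\<^sub>F n in sequentially. t + ((A *v w) $ r + x (k n)) \<in> P"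
      by eventually_elim (use y(2) in auto)
  qed
  have "filterlim (\<lambda>n. norm (x n)) at_top sequentially"
    using filterlim_real_sequentially
    by (rule filterlim_at_top_mono) (auto intro!: always_eventually less_imp_le x)
  then have lim: "filterlim (\<lambda>n. norm (x (k n))) at_top sequentially"
    using filterlim_compose filterlim_subseq[OF k] by blast
  \<comment> \<open>Where \<open>z $ j\<close> is 0 the expression is the nonzero
    \<open>w $ j\<close>. Elsewhere it vanishes for just one value of \<open>x (k n)\<close>, which
    the growing norms eventually exceed.\<close>
  have ev2: "\<forall>\<^sub>F n in sequentially. \<forall>j. w $ j + (t + x (k n)) * z $ j \<noteq> 0"
  proof (rule eventually_all_finite)
    fix j
    have "\<forall>\<^sub>F n in sequentially. norm (x (k n)) > norm (w $ j / z $ j + t)"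
      using lim by (simp add: filterlim_at_top_dense)
    then show "\<forall>\<^sub>F n in sequentially. w $ j + (t + x (k n)) * z $ j \<noteq> 0"
    proof eventually_elim
      case (elim n)
      show ?case
      proof
        assume 0: "w $ j + (t + x (k n)) * z $ j = 0"
        have "z $ j \<noteq> 0" using 0 w unfolding vectors_over_def by auto
        then have "x (k n) = - (w $ j / z $ j + t)"
          using 0 by (simp add: field_simps eq_neg_iff_add_eq_0)
        then show False using elim by (metis less_irrefl norm_minus_cancel)
      qed
    qed
  qed
  obtain n where n: "\<And>r. t + ((A *v w) $ r + x (k n)) \<in> P" "\<And>j. w $ j + (t + x (k n)) * z $ j \<noteq> 0"
    using eventually_happens'[OF sequentially_bot eventually_conj[OF ev1 ev2]] by blast
  define s where "s = t + x (k n)"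
  have "s \<in> gauss_ints" unfolding s_def using t G x by auto
  then have "w + s *s z \<in> vectors_over (gauss_ints - {0})"
    using w z(1) n(2)[folded s_def] unfolding vectors_over_def by simp
  moreover have "A *v (w + s *s z) = A *v w + s *s (\<chi> r. 1)"
    by (simp add: matrix_vector_right_distrib z(2) vector_scalar_commute)
  then have "A *v (w + s *s z) \<in> vectors_over P"
    using n(1) unfolding vectors_over_def s_def by (simp add: add_ac)
  ultimately show ?thesis by blast
qed

theorem theorem2p5:
  fixes A :: "complex ^ 'v ^ 'u"
  assumes "\<And>r c. A $ r $ c \<in> gauss_rats"
    and "image_partition_regular A"
  shows "(\<forall>P. P \<subseteq> gauss_ints - {0} \<longrightarrow> piecewise_syndetic_in gauss_ints P \<longrightarrow>
            (\<exists>z\<in>vectors_over (gauss_ints - {0}). A *v z \<in> vectors_over P))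
     \<longleftrightarrow> (\<exists>z\<in>vectors_over gauss_ints. A *v z = (\<chi> r. 1))"
proof (intro iffI allI impI)
  assume "\<exists>z\<in>vectors_over gauss_ints. A *v z = (\<chi> r. 1)"
  then obtain z where z: "z \<in> vectors_over gauss_ints" "A *v z = (\<chi> r. 1)" by (elim bexE)
  fix P assume "piecewise_syndetic_in gauss_ints P"
  then show "\<exists>z\<in>vectors_over (gauss_ints - {0}). A *v z \<in> vectors_over P"
    by (rule piecewise_syndetic_image_if_solvable[OF assms(2) z])
qed (rule solvable_if_piecewise_syndetic_images)

end
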